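(* Let $\mu$ be a probability measure on $(\mathbb{R}^d,\mathcal{B}(\mathbb{R}^d))$, and let $\{D_t,\ t\in[0,1]\}$ be a family of closed subsets of $\mathbb{R}^d$ such that: (i) $D_s\subset D_t$ for $s\le t$; (ii) $\mu(D_0)=0$, $\mu(D_t)<1$ for $t<1$, and $D_1=\mathbb{R}^d$; (iii) for every $t\in(0,1]$, $\mu\bigl(D_t\setminus\bigcup_{s<t}D_s\bigr)=0$, and for every $t\in[0,1)$, $D_t=\bigcap_{s>t}D_s$. Let $g:\mathbb{R}^d\to[0,\infty)$ be a Borel-measurable function that is square-integrable with respect to $\mu$. Set $Q_t=\mathbb{R}^d\setminus D_t$, $$G_t=\frac{1}{\mu(Q_t)}\int_{Q_t}g(y)\,\mu(dy),\quad t\in[0,1),\qquad \tau(x)=\inf\{t\in[0,1]:x\in D_t\},\quad x\in\mathbb{R}^d.$$ Then $$\mathbf{Ent}_\mu\, g\le\int_{\mathbb{R}^d}\frac{\bigl(g(x)-G_{\tau(x)}\bigr)^2}{G_{\tau(x)}}\,\mu(dx).$$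
   Context: For a nonnegative $\mu$-integrable function $g$, $\mathbf{Ent}_\mu\, g=\int g\log g\,d\mu-\bigl(\int g\,d\mu\bigr)\log\bigl(\int g\,d\mu\bigr)$, with $0\log 0=0$. By (ii) and (iii), $\tau(x)<1$ for $\mu$-a.e. $x$, so $G_{\tau(x)}$ is defined for $\mu$-a.e. $x$, and the integral on the right-hand side is understood over the set $\{\tau<1\}$ of full $\mu$-measure. The integrand is $[0,\infty]$-valued, with the conventions $0/0=0$ and $c/0=+\infty$ for $c>0$. *)

theory Defs
  imports "HOL-Probability.Probability"
begin

(* The entropy functional, with values in (-oo, oo] for nonnegative integrable g on a probability
   space: the negative part of g ln g is bounded, so only its positive part can have infinite
   integral. The convention 0 ln 0 = 0 holds automatically. *)
definition Ent :: "'a measure \<Rightarrow> ('a \<Rightarrow> real) \<Rightarrow> ereal" where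
  "Ent M g =
     enn2ereal (\<integral>\<^sup>+x. ennreal (g x * ln (g x)) \<partial>M)
     - enn2ereal (\<integral>\<^sup>+x. ennreal (- (g x * ln (g x))) \<partial>M)
     - ereal ((\<integral>x. g x \<partial>M) * ln (\<integral>x. g x \<partial>M))"

definition avg_outside :: "'a measure \<Rightarrow> (real \<Rightarrow> 'a set) \<Rightarrow> ('a \<Rightarrow> real) \<Rightarrow> real \<Rightarrow> real" where
  "avg_outside M D g t = 1 / measure M (- D t) * (LINT y:(- D t)|M. g y)"

definition entry_time :: "(real \<Rightarrow> 'a set) \<Rightarrow> 'a \<Rightarrow> real" where
  "entry_time D x = Inf {t \<in> {0..1}. x \<in> D t}"

lemma Ent_eq_integral:
  assumes "integrable M (\<lambda>x. g x * ln (g x))"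
  shows "Ent M g =
    ereal ((\<integral>x. g x * ln (g x) \<partial>M) - (\<integral>x. g x \<partial>M) * ln (\<integral>x. g x \<partial>M))"
proof -
  let ?f = "\<lambda>x. g x * ln (g x)"
  have fin: "(\<integral>\<^sup>+x. ennreal (?f x) \<partial>M) \<noteq> \<infinity>" "(\<integral>\<^sup>+x. ennreal (- ?f x) \<partial>M) \<noteq> \<infinity>"
    using assms by (auto simp: real_integrable_def)
  obtain a where a: "a \<ge> 0" "(\<integral>\<^sup>+x. ennreal (?f x) \<partial>M) = ennreal a"
    using fin(1) by (cases "\<integral>\<^sup>+x. ennreal (?f x) \<partial>M") auto
  obtain b where b: "b \<ge> 0" "(\<integral>\<^sup>+x. ennreal (- ?f x) \<partial>M) = ennreal b"
    using fin(2) by (cases "\<integral>\<^sup>+x. ennreal (- ?f x) \<partial>M") auto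
  show ?thesis
    unfolding Ent_def real_lebesgue_integral_def[OF assms] a(2) b(2)
    using a(1) b(1) by (simp add: enn2ereal_ennreal)
qed

lemma integrable_mult_ln:
  fixes g :: "'a \<Rightarrow> real"
  assumes "finite_measure M" and [measurable]: "g \<in> borel_measurable M"
    and nonneg: "\<And>x. 0 \<le> g x" and sq: "integrable M (\<lambda>x. (g x)\<^sup>2)"
  shows "integrable M (\<lambda>x. g x * ln (g x))"
proof (rule Bochner_Integration.integrable_bound)
  show "integrable M (\<lambda>x. 1 + (g x)\<^sup>2)"
    by (rule Bochner_Integration.integrable_add[OF finite_measure.integrable_const[OF assms(1)] sq])
  have "\<bar>y * ln y\<bar> \<le> 1 + y\<^sup>2" if "0 \<le> y" for y :: real
  proof (cases "y = 0")
    case False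
    with that have y: "y > 0" by simp
    have "y * ln y \<le> y * y"
      using ln_le_minus_one[OF y] y by (intro mult_left_mono) auto
    moreover have "y * (- ln y) \<le> y * (1 / y)"
      using ln_le_minus_one[of "1 / y"] y by (intro mult_left_mono) (auto simp: ln_div)
    moreover have "0 \<le> y * y" using y by simp
    moreover have "y * (1 / y) = 1" using y by simp
    moreover have "y * (- ln y) = - (y * ln y)" by simp
    ultimately show ?thesis unfolding power2_eq_square abs_le_iff by linarith
  qed simp
  then show "AE x in M. norm (g x * ln (g x)) \<le> norm (1 + (g x)\<^sup>2)"
    using nonneg by auto
qed measurable

end

theory Submission
  imports Defs "HOL-Real_Asymp.Real_Asymp"
begin

text \<open>
  Write \<open>M t\<close> for the integral of \<open>g\<close> over \<open>{\<tau> > t}\<close> and \<open>N t\<close> for the probability of \<open>{\<tau> > t}\<close>,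
  so that \<open>G = M / N\<close>. Monotonicity and right-continuity of the family give \<open>D t = {\<tau> \<le> t}\<close>,
  closedness of the sets then makes \<open>\<tau>\<close> a random variable, and left-continuity up to null sets, with
  \<open>D 0\<close> null, says that \<open>\<tau>\<close> has an atomless law. The proof is therefore carried out for such
  a time on an arbitrary probability space.

  The inequality \<open>ln z \<le> z - 1\<close> at \<open>z = g / G\<close> gives pointwise
  \<open>g ln g - (g ln G + g - G) \<le> (g - G)\<^sup>2 / G\<close>, where the bracket is the tangent of \<open>y ln y\<close> at \<open>G\<close>,
  evaluated at \<open>g\<close> (lemma \<open>entropy_divergence_bounds\<close>). With \<open>G = G_\<tau>\<close> it remains to see that the
  integral of the tangent term is at most \<open>M 0 ln (M 0)\<close>. Integrals of functions of \<open>\<tau>\<close> are Stieltjes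
  integrals against \<open>- dM\<close> (with weight \<open>g\<close>) and \<open>- dN\<close>, and since
  \<open>d (M ln G) = (ln G + 1) dM - G dN\<close>, the tangent term integrates over \<open>{\<tau> \<le> T}\<close> to
  \<open>M 0 ln (M 0) - M T ln (G T)\<close>.

  Only an upper bound is needed, and it comes without Stieltjes calculus: on a short piece
  \<open>{s < \<tau> \<le> t}\<close> the tangent at \<open>G_\<tau>\<close> is replaced, up to a small error, by the one at \<open>G_t\<close>, whose
  integral is at most \<open>M s ln (G s) - M t ln (G t)\<close>, again by \<open>ln z \<le> z - 1\<close>
  (lemmas \<open>tangent_increment\<close> and \<open>le_of_small_increments\<close>). The whole argument needs \<open>G\<close> to be
  bounded away from zero, so it is run up to a time \<open>T\<close> with \<open>M T > 0\<close>. Finally \<open>T\<close> increases along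
  times with \<open>M T \<rightarrow> 0\<close>: the boundary term is at least \<open>M T ln (M T) \<rightarrow> 0\<close> because \<open>N \<le> 1\<close>, and \<open>g\<close>
  vanishes almost everywhere on the part of the space never reached.
\<close>

section \<open>Real-variable inequalities\<close>

text \<open>
  A discrete substitute for "the derivative of \<open>F\<close> with respect to \<open>V\<close> is at most zero": summing the
  increments over an equidistant partition telescopes both sides, and \<open>e\<close> is arbitrary.
\<close>
lemma le_of_small_increments:
  fixes F V :: "real \<Rightarrow> real"
  assumes "a \<le> b"
    and incr: "\<And>e. e > 0 \<Longrightarrow> \<exists>d>0. \<forall>s t. a \<le> s \<longrightarrow> s \<le> t \<longrightarrow> t \<le> b \<longrightarrow> t - s < d
                 \<longrightarrow> F t - F s \<le> e * (V t - V s)"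
  shows "F b \<le> F a"
proof -
  have scaled: "F b - F a \<le> e * (V b - V a)" if "e > 0" for e
  proof -
    obtain d where d: "d > 0" "\<And>s t. a \<le> s \<Longrightarrow> s \<le> t \<Longrightarrow> t \<le> b \<Longrightarrow> t - s < d
        \<Longrightarrow> F t - F s \<le> e * (V t - V s)"
      using incr[OF \<open>e > 0\<close>] by blast
    obtain n :: nat where n: "(b - a) / d < real n"
      using reals_Archimedean2 by blast
    have n0: "real n > 0"
      using n divide_nonneg_pos[of "b - a" d] \<open>a \<le> b\<close> d(1) by linarith
    define u where "u i = a + real i * ((b - a) / real n)" for i :: nat
    have step: "u (Suc i) - u i = (b - a) / real n" for i
      by (simp add: u_def distrib_right add_divide_distrib)
    have small: "(b - a) / real n < d"
      using n n0 d(1) by (simp add: field_simps)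
    have u_le: "u i \<le> u (Suc i)" for i
      using step[of i] n0 \<open>a \<le> b\<close> divide_nonneg_pos[of "b - a" "real n"] by linarith
    have u_ge: "a \<le> u i" for i
      using \<open>a \<le> b\<close> n0 by (simp add: u_def)
    have un: "u n = b" "u 0 = a"
      using n0 by (auto simp: u_def)
    have u_b: "u i \<le> b" if "i \<le> n" for i
    proof -
      have "real i * ((b - a) / real n) \<le> real n * ((b - a) / real n)"
        using that \<open>a \<le> b\<close> n0 by (intro mult_right_mono) auto
      then show ?thesis using n0 by (simp add: u_def)
    qed
    have "F b - F a = (\<Sum>i<n. F (u (Suc i)) - F (u i))"
      by (subst sum_lessThan_telescope) (simp add: un)
    also have "\<dots> \<le> (\<Sum>i<n. e * (V (u (Suc i)) - V (u i)))"
      using d(2) u_ge u_le u_b step small by (intro sum_mono) (auto simp: Suc_le_eq)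
    also have "\<dots> = e * (V b - V a)"
      unfolding sum_distrib_left[symmetric] by (subst sum_lessThan_telescope) (simp add: un)
    finally show ?thesis .
  qed
  have "((\<lambda>e. e * (V b - V a)) \<longlongrightarrow> 0 * (V b - V a)) (at_right 0)"
    by (intro tendsto_intros)
  moreover have "eventually (\<lambda>e. F b - F a \<le> e * (V b - V a)) (at_right 0)"
    using scaled by (auto simp: eventually_at_right_less intro: eventually_at_rightI[of 0 1])
  ultimately have "F b - F a \<le> 0 * (V b - V a)"
    by (intro tendsto_lowerbound) auto
  then show ?thesis by simp
qed

text \<open>
  The quantity is the Bregman divergence of \<open>y ln y\<close>. Both bounds are \<open>ln z \<le> z - 1\<close>, at \<open>z = G / y\<close>
  and at \<open>z = y / G\<close>.
\<close>
lemma entropy_divergence_bounds: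
  fixes y G :: real
  assumes "0 \<le> y" "0 < G"
  shows "0 \<le> y * ln y - (y * ln G + y - G)"
    and "y * ln y - (y * ln G + y - G) \<le> (y - G)\<^sup>2 / G"
proof -
  have "0 \<le> y * ln y - (y * ln G + y - G) \<and> y * ln y - (y * ln G + y - G) \<le> (y - G)\<^sup>2 / G"
  proof (cases "y = 0")
    case True
    then show ?thesis using assms by (simp add: power2_eq_square)
  next
    case False
    then have y: "y > 0" using assms by simp
    have "y * (ln G - ln y) \<le> y * (G / y - 1)"
      using ln_le_minus_one[of "G / y"] y assms by (intro mult_left_mono) (auto simp: ln_div)
    moreover have "y * (ln y - ln G) \<le> y * (y / G - 1)"
      using ln_le_minus_one[of "y / G"] y assms by (intro mult_left_mono) (auto simp: ln_div)
    moreover have "y * (G / y - 1) = G - y" using y by (simp add: field_simps)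
    moreover have "y * (y / G - 1) - y + G = (y - G)\<^sup>2 / G"
      using assms by (simp add: field_simps power2_eq_square)
    ultimately show ?thesis by (simp add: algebra_simps)
  qed
  then show "0 \<le> y * ln y - (y * ln G + y - G)"
    "y * ln y - (y * ln G + y - G) \<le> (y - G)\<^sup>2 / G" by auto
qed

section \<open>Conditional means beyond an atomless random time\<close>

locale atomless_time = prob_space M for M :: "'a measure" +
  fixes \<tau> :: "'a \<Rightarrow> real" and g :: "'a \<Rightarrow> real"
  assumes time_measurable [measurable]: "\<tau> \<in> borel_measurable M"
    and time_nonneg: "\<And>x. x \<in> space M \<Longrightarrow> 0 \<le> \<tau> x"
    and time_le_one: "\<And>x. x \<in> space M \<Longrightarrow> \<tau> x \<le> 1"
    and atomless: "\<And>t. AE x in M. \<tau> x \<noteq> t"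
    and g_measurable [measurable]: "g \<in> borel_measurable M"
    and g_nonneg: "\<And>x. 0 \<le> g x"
    and g_square: "integrable M (\<lambda>x. (g x)\<^sup>2)"
begin

definition later :: "real \<Rightarrow> 'a set" where
  "later t = {x \<in> space M. t < \<tau> x}"

definition between :: "real \<Rightarrow> real \<Rightarrow> 'a set" where
  "between s t = {x \<in> space M. s < \<tau> x \<and> \<tau> x \<le> t}"

definition mass :: "real \<Rightarrow> real" where
  "mass t = (LINT x:later t|M. g x)"

definition mean :: "real \<Rightarrow> real" where
  "mean t = mass t / prob (later t)"

lemma later_sets [measurable]: "later t \<in> sets M"
  unfolding later_def by measurable

lemma between_sets [measurable]: "between s t \<in> sets M"
  unfolding between_def by measurable

lemma g_integrable: "integrable M g"
proof (rule Bochner_Integration.integrable_bound)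
  show "integrable M (\<lambda>x. 1 + (g x)\<^sup>2)"
    by (intro Bochner_Integration.integrable_add g_square) simp
  have "\<bar>y\<bar> \<le> 1 + y\<^sup>2" for y :: real
  proof -
    have "(\<bar>y\<bar> - 1)\<^sup>2 = y\<^sup>2 - 2 * \<bar>y\<bar> + 1" by (simp add: power2_diff)
    then show ?thesis
      using zero_le_power2[of "\<bar>y\<bar> - 1"] zero_le_power2[of y] by linarith
  qed
  then show "AE x in M. norm (g x) \<le> norm (1 + (g x)\<^sup>2)" by (auto simp: abs_of_nonneg)
qed measurable

text \<open>
  This is where atomlessness enters: the indicators of \<open>{\<tau> > u}\<close> converge to that of \<open>{\<tau> > t}\<close> as
  \<open>u \<rightarrow> t\<close> except on the null set \<open>{\<tau> = t}\<close>.
\<close>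
lemma tail_integral_continuous:
  fixes f :: "'a \<Rightarrow> real"
  assumes f: "integrable M f"
  shows "continuous_on S (\<lambda>t. LINT x:later t|M. f x)"
proof (rule continuous_at_imp_continuous_on, intro ballI)
  fix t
  note [measurable] = borel_measurable_integrable[OF f]
  show "isCont (\<lambda>t. LINT x:later t|M. f x) t"
    unfolding continuous_at_sequentially comp_def set_lebesgue_integral_def
  proof (intro allI impI)
    fix u :: "nat \<Rightarrow> real"
    assume u: "u \<longlonglongrightarrow> t"
    show "(\<lambda>n. LINT x|M. indicator (later (u n)) x *\<^sub>R f x)
        \<longlonglongrightarrow> (LINT x|M. indicator (later t) x *\<^sub>R f x)"
    proof (rule integral_dominated_convergence[where w = "\<lambda>x. norm (f x)"])
      show "AE x in M. (\<lambda>n. indicator (later (u n)) x *\<^sub>R f x)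
          \<longlonglongrightarrow> indicator (later t) x *\<^sub>R f x"
        using atomless[of t]
      proof eventually_elim
        case (elim x)
        then have "eventually (\<lambda>n. (u n < \<tau> x) = (t < \<tau> x)) sequentially"
        proof (cases "t < \<tau> x")
          case True
          then show ?thesis using order_tendstoD(2)[OF u True] by (auto elim: eventually_mono)
        next
          case False
          then have "\<tau> x < t" using elim by simp
          from order_tendstoD(1)[OF u this] show ?thesis
            by eventually_elim (use False in auto)
        qed
        then show ?case
          by (intro tendsto_eventually, elim eventually_mono)
             (auto simp: later_def indicator_def)
      qed
      show "integrable M (\<lambda>x. norm (f x))" using f by simp
    qed (auto simp: indicator_def)
  qed
qed

lemma prob_later_eq: "prob (later t) = (LINT x:later t|M. 1)"
  by (simp add: set_lebesgue_integral_def)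

lemma mass_continuous: "continuous_on S mass"
  unfolding mass_def by (rule tail_integral_continuous[OF g_integrable])

lemma prob_later_continuous: "continuous_on S (\<lambda>t. prob (later t))"
  unfolding prob_later_eq by (rule tail_integral_continuous) simp

lemma mean_measurable [measurable]: "mean \<in> borel_measurable borel"
  unfolding mean_def
  by (intro borel_measurable_divide borel_measurable_continuous_onI
        mass_continuous prob_later_continuous)

lemma g_set_integrable: "A \<in> sets M \<Longrightarrow> set_integrable M A g"
  using g_integrable integrable_mult_indicator set_integrable_def by blast

lemma g_set_integral_mono:
  assumes "A \<in> sets M" "B \<in> sets M" "A \<subseteq> B"
  shows "(LINT x:A|M. g x) \<le> (LINT x:B|M. g x)"
  unfolding set_lebesgue_integral_def
proof (rule integral_mono)
  show "integrable M (\<lambda>x. indicator A x *\<^sub>R g x)" "integrable M (\<lambda>x. indicator B x *\<^sub>R g x)"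
    using g_set_integrable assms by (auto simp: set_integrable_def)
qed (use assms(3) g_nonneg in \<open>auto simp: indicator_def\<close>)

lemma g_set_integral_nonneg: "0 \<le> (LINT x:A|M. g x)"
  unfolding set_lebesgue_integral_def
  by (rule Bochner_Integration.integral_nonneg) (simp add: g_nonneg)

lemma mass_antimono: "s \<le> t \<Longrightarrow> mass t \<le> mass s"
  unfolding mass_def by (intro g_set_integral_mono) (auto simp: later_def)

lemma mass_nonneg: "0 \<le> mass t"
  unfolding mass_def by (rule g_set_integral_nonneg)

lemma mass_zero: "mass 0 = integral\<^sup>L M g"
proof -
  have "AE x in M. indicator (later 0) x *\<^sub>R g x = g x"
    using atomless[of 0] AE_space
    by eventually_elim (use time_nonneg in \<open>force simp: later_def indicator_def\<close>)
  then show ?thesis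
    unfolding mass_def set_lebesgue_integral_def by (intro integral_cong_AE) auto
qed

lemma mass_one: "mass 1 = 0"
proof -
  have "later 1 = {}" using time_le_one by (auto simp: later_def not_less)
  then show ?thesis by (simp add: mass_def set_lebesgue_integral_def)
qed

lemma prob_later_pos: "0 < mass t \<Longrightarrow> 0 < prob (later t)"
proof (rule ccontr)
  assume m: "0 < mass t" and "\<not> 0 < prob (later t)"
  then have "prob (later t) = 0" using measure_nonneg[of M "later t"] by linarith
  then have "later t \<in> null_sets M"
    by (simp add: emeasure_eq_measure null_setsI)
  then have "mass t = 0"
    unfolding mass_def set_lebesgue_integral_def
    by (intro integral_eq_zero_AE) (auto dest!: AE_not_in simp: indicator_def elim: eventually_mono)
  with m show False by simp
qed

lemma mean_pos: "0 < mass t \<Longrightarrow> 0 < mean t"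
  using prob_later_pos by (simp add: mean_def)

lemma mass_le_mean: "0 < mass t \<Longrightarrow> mass t \<le> mean t"
  using prob_later_pos[of t] prob_le_1[of "later t"] by (simp add: mean_def field_simps)

text \<open>
  While mass is left, the mean stays in a compact subset of the positive half-line. This makes
  \<open>ln (mean (\<tau> x))\<close> bounded on \<open>{\<tau> \<le> T}\<close>.
\<close>
lemma mean_bounds:
  assumes "0 < mass T" "0 \<le> t" "t \<le> T"
  shows "mass T \<le> mean t" "mean t \<le> mass 0 / prob (later T)"
proof -
  have t: "0 < mass t" "mass T \<le> mass t" "mass t \<le> mass 0"
    using mass_antimono assms by (auto intro: less_le_trans)
  show "mass T \<le> mean t" using mass_le_mean[OF t(1)] t(2) by linarith
  have "prob (later T) \<le> prob (later t)"
    using assms by (intro finite_measure_mono) (auto simp: later_def)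
  then show "mean t \<le> mass 0 / prob (later T)"
    unfolding mean_def using t prob_later_pos[OF assms(1)] by (intro frac_le) auto
qed

section \<open>Integrating the tangents of the entropy function\<close>

text \<open>The tangent of \<open>y ln y\<close> at \<open>mean (\<tau> x)\<close>, evaluated at \<open>g x\<close>.\<close>
definition tangent :: "'a \<Rightarrow> real" where
  "tangent x = g x * ln (mean (\<tau> x)) + g x - mean (\<tau> x)"

lemma tangent_integrable:
  assumes T: "0 < mass T" "0 \<le> s" "t \<le> T"
  shows "set_integrable M (between s t) tangent"
  unfolding set_integrable_def
proof (rule Bochner_Integration.integrable_bound)
  let ?K = "\<bar>ln (mass T)\<bar> + \<bar>ln (mass 0 / prob (later T))\<bar>"
  let ?L = "mass 0 / prob (later T)"
  show "integrable M (\<lambda>x. g x * ?K + g x + ?L)"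
    using g_integrable by (intro Bochner_Integration.integrable_add) auto
  show "(\<lambda>x. indicator (between s t) x *\<^sub>R tangent x) \<in> borel_measurable M"
    unfolding tangent_def by measurable
  show "AE x in M. norm (indicator (between s t) x *\<^sub>R tangent x) \<le> norm (g x * ?K + g x + ?L)"
  proof (rule AE_I2)
    fix x
    have L: "0 \<le> ?L" using mass_nonneg by simp
    have r: "0 \<le> g x * ?K + g x + ?L" using L g_nonneg[of x] by simp
    show "norm (indicator (between s t) x *\<^sub>R tangent x) \<le> norm (g x * ?K + g x + ?L)"
    proof (cases "x \<in> between s t")
      case True
      then have b: "mass T \<le> mean (\<tau> x)" "mean (\<tau> x) \<le> ?L"
        using T by (auto simp: between_def intro!: mean_bounds)
      have p: "0 < mean (\<tau> x)" using b T by linarith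
      have "ln (mass T) \<le> ln (mean (\<tau> x))" "ln (mean (\<tau> x)) \<le> ln ?L"
        using b T p by auto
      then have "\<bar>ln (mean (\<tau> x))\<bar> \<le> ?K" by linarith
      then have "g x * \<bar>ln (mean (\<tau> x))\<bar> \<le> g x * ?K"
        using g_nonneg by (intro mult_left_mono) auto
      then have "\<bar>g x * ln (mean (\<tau> x))\<bar> \<le> g x * ?K"
        using g_nonneg[of x] by (simp add: abs_mult)
      then have "\<bar>tangent x\<bar> \<le> g x * ?K + g x + ?L"
        unfolding tangent_def using b p g_nonneg[of x] by linarith
      then show ?thesis using r True by simp
    qed (use r in simp)
  qed
qed

lemma later_split: 
  fixes f :: "'a \<Rightarrow> real"
  assumes "s \<le> t" "integrable M f"
  shows "(LINT x:between s t|M. f x) = (LINT x:later s|M. f x) - (LINT x:later t|M. f x)"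
proof -
  have "later s = between s t \<union> later t" "between s t \<inter> later t = {}"
    using assms(1) by (auto simp: later_def between_def)
  moreover have "set_integrable M A f" if "A \<in> sets M" for A
    using that assms(2) integrable_mult_indicator set_integrable_def by blast
  ultimately show ?thesis by (simp add: set_integral_Un)
qed

text \<open>
  The mean is frozen at the right end point \<open>t\<close> of the interval. The error committed is \<open>e\<close> times the
  \<open>(1 + g)\<close>-weighted measure of \<open>{s < \<tau> \<le> t}\<close>, which is additive in the interval. For the frozen
  tangent the integral is explicit, and comparing it with the increment of \<open>mass * ln mean\<close> leaves
  \<open>mass s * (z - 1 - ln z)\<close> with \<open>z = mean t / mean s\<close>, which has the right sign. Freezing at the left
  end point would give the opposite sign and force a second-order estimate.
\<close>
lemma tangent_increment:
  assumes t: "0 < mass t" "0 \<le> s" "s \<le> t" and "0 \<le> e"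
    and close_mean: "\<And>r. s \<le> r \<Longrightarrow> r \<le> t \<Longrightarrow> \<bar>mean r - mean t\<bar> \<le> e"
    and close_ln: "\<And>r. s \<le> r \<Longrightarrow> r \<le> t \<Longrightarrow> \<bar>ln (mean r) - ln (mean t)\<bar> \<le> e"
  shows "(LINT x:between s t|M. tangent x) + mass t * ln (mean t) - mass s * ln (mean s)
    \<le> e * ((mass s + prob (later s)) - (mass t + prob (later t)))"
proof -
  let ?c = "ln (mean t) + 1 + e" and ?d = "mean t - e"
  have s: "0 < mass s" using mass_antimono[OF t(3)] t by linarith
  have int: "integrable M (\<lambda>x. g x * ?c - ?d)" using g_integrable by simp
  have "(LINT x:between s t|M. tangent x) \<le> (LINT x:between s t|M. g x * ?c - ?d)"
  proof (rule set_integral_mono)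
    show "set_integrable M (between s t) tangent"
      using tangent_integrable t by blast
    show "set_integrable M (between s t) (\<lambda>x. g x * ?c - ?d)"
      using int between_sets integrable_mult_indicator set_integrable_def by blast
    fix x assume "x \<in> between s t"
    then have "\<bar>mean (\<tau> x) - mean t\<bar> \<le> e" "\<bar>ln (mean (\<tau> x)) - ln (mean t)\<bar> \<le> e"
      using close_mean close_ln by (auto simp: between_def)
    moreover from this have "g x * ln (mean (\<tau> x)) \<le> g x * (ln (mean t) + e)"
      using g_nonneg by (intro mult_left_mono) auto
    ultimately show "tangent x \<le> g x * ?c - ?d"
      unfolding tangent_def by (simp add: algebra_simps)
  qed
  also have "\<dots> = (LINT x:later s|M. g x * ?c - ?d) - (LINT x:later t|M. g x * ?c - ?d)"
    by (rule later_split[OF t(3) int])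
  also have "\<dots> = (mass s * ?c - prob (later s) * ?d) - (mass t * ?c - prob (later t) * ?d)"
  proof -
    have "(LINT x:later r|M. g x * ?c - ?d) = mass r * ?c - prob (later r) * ?d" for r
    proof -
      have "set_integrable M (later r) (\<lambda>x. g x * ?c)"
        by (simp add: g_set_integrable)
      moreover have "set_integrable M (later r) (\<lambda>x. ?d)"
        unfolding set_integrable_def by (rule integrable_mult_indicator) auto
      ultimately have "(LINT x:later r|M. g x * ?c - ?d)
          = (LINT x:later r|M. g x * ?c) - (LINT x:later r|M. ?d)"
        by (rule set_integral_diff(2))
      moreover have "(LINT x:later r|M. ?d) = prob (later r) * ?d"
        by (simp add: set_lebesgue_integral_def)
      ultimately show ?thesis by (simp add: mass_def)
    qed
    then show ?thesis by simp
  qed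
  finally have upper: "(LINT x:between s t|M. tangent x)
      \<le> (mass s * ?c - prob (later s) * ?d) - (mass t * ?c - prob (later t) * ?d)" .
  have "mass t = mean t * prob (later t)" "mass s = mean s * prob (later s)"
    using prob_later_pos[OF t(1)] prob_later_pos[OF s] by (auto simp: mean_def)
  note masses = this
  have "mass s * (ln (mean t) - ln (mean s)) \<le> mass s * (mean t / mean s - 1)"
    using ln_le_minus_one[of "mean t / mean s"] mean_pos[OF t(1)] mean_pos[OF s] s
    by (intro mult_left_mono) (auto simp: ln_div)
  also have "\<dots> = mean t * prob (later s) - mass s"
    using masses mean_pos[OF s] by (simp add: field_simps)
  finally have "mass s * (ln (mean t) - ln (mean s)) \<le> mean t * prob (later s) - mass s" .
  then show ?thesis using upper masses(1) by (simp add: algebra_simps)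
qed

text \<open>
  Uniform continuity of the mean and of its logarithm on \<open>[0, T]\<close> provides the small increments. The
  boundary term is weakened from \<open>ln (mean T)\<close> to \<open>ln (mass T)\<close>, because \<open>mass T * ln (mass T)\<close>
  is controlled by \<open>mass T \<rightarrow> 0\<close> alone, even if the mass is exhausted before time \<open>1\<close>.
\<close>
lemma tangent_integral_le:
  assumes T: "0 < mass T" "0 \<le> T"
  shows "(LINT x:between 0 T|M. tangent x) \<le> mass 0 * ln (mass 0) - mass T * ln (mass T)"
proof -
  have pos: "0 < mass t" if "t \<le> T" for t
    using mass_antimono[OF that] T by linarith
  let ?F = "\<lambda>t. (LINT x:between 0 t|M. tangent x) + mass t * ln (mean t)"
  have mean_nonzero: "mean t \<noteq> 0" if "t \<in> {0..T}" for t
    using mean_pos[OF pos[of t]] that by simp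
  have "continuous_on {0..T} mean"
    unfolding mean_def
    by (intro continuous_on_divide mass_continuous prob_later_continuous)
       (use prob_later_pos pos in force)
  moreover from this have "continuous_on {0..T} (\<lambda>t. ln (mean t))"
    by (intro continuous_on_ln ballI) (use mean_nonzero in auto)
  ultimately have uc: "uniformly_continuous_on {0..T} mean"
    "uniformly_continuous_on {0..T} (\<lambda>t. ln (mean t))"
    by (auto intro: compact_uniformly_continuous)
  have "?F T \<le> ?F 0"
  proof (rule le_of_small_increments[OF T(2), where V = "\<lambda>t. - (mass t + prob (later t))"])
    fix e :: real assume e: "e > 0"
    obtain d1 where d1: "d1 > 0" "\<And>r t. r \<in> {0..T} \<Longrightarrow> t \<in> {0..T} \<Longrightarrow> dist r t < d1
        \<Longrightarrow> dist (mean r) (mean t) < e"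
      using uc(1) e unfolding uniformly_continuous_on_def by metis
    obtain d2 where d2: "d2 > 0" "\<And>r t. r \<in> {0..T} \<Longrightarrow> t \<in> {0..T} \<Longrightarrow> dist r t < d2
        \<Longrightarrow> dist (ln (mean r)) (ln (mean t)) < e"
      using uc(2) e unfolding uniformly_continuous_on_def by metis
    show "\<exists>d>0. \<forall>s t. 0 \<le> s \<longrightarrow> s \<le> t \<longrightarrow> t \<le> T \<longrightarrow> t - s < d \<longrightarrow>
        ?F t - ?F s \<le> e * (- (mass t + prob (later t)) - - (mass s + prob (later s)))"
    proof (intro exI[of _ "min d1 d2"] conjI allI impI)
      show "0 < min d1 d2" using d1 d2 by simp
      fix s t :: real
      assume st: "0 \<le> s" "s \<le> t" "t \<le> T" "t - s < min d1 d2"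
      have close: "\<bar>mean r - mean t\<bar> \<le> e" "\<bar>ln (mean r) - ln (mean t)\<bar> \<le> e"
        if "s \<le> r" "r \<le> t" for r
        using d1(2)[of r t] d2(2)[of r t] st that by (auto simp: dist_real_def)
      have "between 0 t = between 0 s \<union> between s t" "between 0 s \<inter> between s t = {}"
        using st by (auto simp: between_def)
      then have "(LINT x:between 0 t|M. tangent x)
          = (LINT x:between 0 s|M. tangent x) + (LINT x:between s t|M. tangent x)"
        using st T by (simp add: set_integral_Un tangent_integrable[of T])
      moreover have "(LINT x:between s t|M. tangent x) + mass t * ln (mean t) - mass s * ln (mean s)
          \<le> e * ((mass s + prob (later s)) - (mass t + prob (later t)))"
        using st e pos close by (intro tangent_increment) auto
      ultimately show "?F t - ?F s \<le> e * (- (mass t + prob (later t)) - - (mass s + prob (later s)))"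
        by (simp add: algebra_simps)
    qed
  qed
  moreover have "between 0 0 = {}" by (auto simp: between_def)
  moreover have "mean 0 = mass 0"
  proof -
    have "AE x in M. x \<in> later 0"
      using atomless[of 0] AE_space
      by eventually_elim (use time_nonneg in \<open>force simp: later_def\<close>)
    then have "prob (later 0) = 1" by (simp add: prob_eq_1)
    then show ?thesis by (simp add: mean_def)
  qed
  moreover have "mass T * ln (mass T) \<le> mass T * ln (mean T)"
    using T mass_le_mean mean_pos by (intro mult_left_mono) auto
  ultimately show ?thesis by (simp add: set_lebesgue_integral_def)
qed

section \<open>The entropy bound\<close>

definition energy :: ennreal where
  "energy = (\<integral>\<^sup>+x. ennreal ((g x - mean (\<tau> x))\<^sup>2) / ennreal (mean (\<tau> x)) \<partial>M)"

lemma truncated_entropy_le: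
  assumes T: "0 < mass T" "0 \<le> T"
  shows "ennreal ((LINT x:between 0 T|M. g x * ln (g x))
      - mass 0 * ln (mass 0) + mass T * ln (mass T)) \<le> energy"
proof -
  let ?h = "\<lambda>x. g x * ln (g x) - tangent x"
  have pos: "0 < mean (\<tau> x)" if "x \<in> between 0 T" for x
    using mean_bounds(1)[OF T(1), of "\<tau> x"] T that by (auto simp: between_def)
  have i1: "set_integrable M (between 0 T) (\<lambda>x. g x * ln (g x))"
    using integrable_mult_ln[OF _ g_measurable g_nonneg g_square] finite_measure_axioms
      between_sets integrable_mult_indicator set_integrable_def by blast
  have i2: "set_integrable M (between 0 T) tangent"
    using tangent_integrable T by blast
  have i3: "integrable M (\<lambda>x. indicator (between 0 T) x *\<^sub>R ?h x)"
    using set_integral_diff(1)[OF i1 i2] by (simp add: set_integrable_def)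
  have "(LINT x:between 0 T|M. g x * ln (g x)) - mass 0 * ln (mass 0) + mass T * ln (mass T)
      \<le> (LINT x:between 0 T|M. ?h x)"
    using tangent_integral_le[OF T] set_integral_diff(2)[OF i1 i2] by simp
  then have "ennreal ((LINT x:between 0 T|M. g x * ln (g x)) - mass 0 * ln (mass 0)
      + mass T * ln (mass T)) \<le> ennreal (LINT x:between 0 T|M. ?h x)"
    by (rule ennreal_leI)
  also have "\<dots> = (\<integral>\<^sup>+x. ennreal (indicator (between 0 T) x *\<^sub>R ?h x) \<partial>M)"
    unfolding set_lebesgue_integral_def
    by (rule nn_integral_eq_integral[OF i3, symmetric])
       (use entropy_divergence_bounds(1)[OF g_nonneg pos] in
         \<open>auto simp: indicator_def tangent_def\<close>)
  also have "\<dots> \<le> energy"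
    unfolding energy_def
  proof (rule nn_integral_mono)
    fix x
    show "ennreal (indicator (between 0 T) x *\<^sub>R ?h x)
        \<le> ennreal ((g x - mean (\<tau> x))\<^sup>2) / ennreal (mean (\<tau> x))"
    proof (cases "x \<in> between 0 T")
      case True
      then show ?thesis
        using entropy_divergence_bounds(2)[OF g_nonneg pos[OF True]] pos[OF True]
        by (simp add: divide_ennreal tangent_def ennreal_leI)
    qed simp
  qed
  finally show ?thesis .
qed

text \<open>
  Exhaustion by times with \<open>mass (T n) = mass 0 / (n + 1)\<close>. Choosing the times through the mass treats
  at once the case where \<open>g\<close> vanishes beyond some time before \<open>1\<close> and the case where it does not.
\<close>
theorem Ent_le_energy: "Ent M g \<le> enn2ereal energy"
proof -
  have int: "integrable M (\<lambda>x. g x * ln (g x))"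
    using integrable_mult_ln[OF _ g_measurable g_nonneg g_square] finite_measure_axioms by blast
  consider "mass 0 = 0" | "mass 0 > 0" using mass_nonneg[of 0] by linarith
  then have "ennreal ((\<integral>x. g x * ln (g x) \<partial>M) - mass 0 * ln (mass 0)) \<le> energy"
  proof cases
    case 1
    then have "AE x in M. g x = 0"
      using integral_nonneg_eq_0_iff_AE[OF g_integrable] g_nonneg mass_zero by simp
    then have "(\<integral>x. g x * ln (g x) \<partial>M) = 0"
      by (intro integral_eq_zero_AE) (auto elim: eventually_mono)
    then show ?thesis using 1 by simp
  next
    case 2
    have "\<exists>t. 0 \<le> t \<and> t \<le> 1 \<and> mass t = mass 0 / real (n + 1)" for n
      by (rule IVT2') (use 2 mass_one mass_continuous in \<open>auto simp: field_simps\<close>)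
    then obtain T where T: "\<And>n. 0 \<le> T n" "\<And>n. mass (T n) = mass 0 / real (n + 1)"
      by metis
    have T_pos: "0 < mass (T n)" for n using T(2) 2 by simp
    have mass_lim: "(\<lambda>n. mass (T n)) \<longlonglongrightarrow> 0"
    proof -
      have "(\<lambda>n. m / real (n + 1)) \<longlonglongrightarrow> 0" for m :: real by real_asymp
      then show ?thesis unfolding T(2) .
    qed
    have ln_lim: "(\<lambda>n. mass (T n) * ln (mass (T n))) \<longlonglongrightarrow> 0"
    proof -
      have "(\<lambda>n. m / real (n + 1) * ln (m / real (n + 1))) \<longlonglongrightarrow> 0" if "0 < m" for m :: real
        using that by real_asymp
      then show ?thesis unfolding T(2) using 2 by blast
    qed
    \<comment> \<open>On the part that no \<open>T n\<close> reaches, \<open>g\<close> has integral \<open>0\<close>, so it contributes no entropy.\<close>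
    let ?A = "\<Inter>n. later (T n)"
    have "(LINT x:?A|M. g x) \<le> 0"
    proof (rule LIMSEQ_le_const[OF mass_lim], intro exI allI impI)
      fix n
      show "(LINT x:?A|M. g x) \<le> mass (T n)"
        unfolding mass_def by (intro g_set_integral_mono) auto
    qed
    moreover have "0 \<le> (LINT x:?A|M. g x)"
      by (rule g_set_integral_nonneg)
    ultimately have "(LINT x|M. indicator ?A x *\<^sub>R g x) = 0"
      by (simp add: set_lebesgue_integral_def)
    then have null: "AE x in M. indicator ?A x *\<^sub>R g x = 0"
      using integral_nonneg_eq_0_iff_AE[of M "\<lambda>x. indicator ?A x *\<^sub>R g x"]
        g_set_integrable[of ?A] g_nonneg by (simp add: set_integrable_def)
    have anti: "T m \<le> T n" if "m \<le> n" for m n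
    proof (rule ccontr)
      assume c: "\<not> T m \<le> T n"
      with that have "m < n" by (cases "m = n") auto
      have "mass (T m) \<le> mass (T n)" using c mass_antimono by simp
      then show False using \<open>m < n\<close> 2 unfolding T(2) by (simp add: field_simps)
    qed
    have "(\<lambda>n. LINT x:between 0 (T n)|M. g x * ln (g x)) \<longlonglongrightarrow> (\<integral>x. g x * ln (g x) \<partial>M)"
      unfolding set_lebesgue_integral_def
    proof (rule integral_dominated_convergence[where w = "\<lambda>x. norm (g x * ln (g x))"])
      show "AE x in M. (\<lambda>n. indicator (between 0 (T n)) x *\<^sub>R (g x * ln (g x)))
          \<longlonglongrightarrow> g x * ln (g x)"
        using null atomless[of 0] AE_space
      proof eventually_elim
        case (elim x)
        show ?case
        proof (cases "x \<in> ?A")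
          case True
          then show ?thesis using elim by simp
        next
          case False
          then obtain m where "\<tau> x \<le> T m" using elim by (auto simp: later_def not_less)
          then have "x \<in> between 0 (T n)" if "m \<le> n" for n
            using anti[OF that] elim time_nonneg[of x] by (auto simp: between_def)
          then show ?thesis
            by (intro tendsto_eventually eventually_sequentiallyI[of m]) simp
        qed
      qed
      show "integrable M (\<lambda>x. norm (g x * ln (g x)))"
        using int by (rule integrable_norm)
    qed (auto simp: indicator_def)
    then have "(\<lambda>n. (LINT x:between 0 (T n)|M. g x * ln (g x))
          - mass 0 * ln (mass 0) + mass (T n) * ln (mass (T n)))
        \<longlonglongrightarrow> (\<integral>x. g x * ln (g x) \<partial>M) - mass 0 * ln (mass 0) + 0"
      by (intro tendsto_add tendsto_diff tendsto_const ln_lim)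
    then show ?thesis
      using truncated_entropy_le[OF T_pos T(1)]
      by (intro LIMSEQ_le_const2[OF tendsto_ennrealI]) auto
  qed
  moreover have "ereal r \<le> enn2ereal (ennreal r)" for r
    by (cases "0 \<le> r") (auto simp: enn2ereal_ennreal ennreal_neg zero_ennreal.rep_eq)
  ultimately have "ereal ((\<integral>x. g x * ln (g x) \<partial>M) - mass 0 * ln (mass 0)) \<le> enn2ereal energy"
    by (meson less_eq_ennreal.rep_eq order_trans)
  then show ?thesis
    using Ent_eq_integral[OF int] mass_zero by simp
qed

end

theorem theorem2:
  fixes \<mu> :: "(real ^ 'd) measure"
    and D :: "real \<Rightarrow> (real ^ 'd) set"
    and g :: "real ^ 'd \<Rightarrow> real"
  assumes "prob_space \<mu>" and "sets \<mu> = sets borel"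
    and "\<And>t. t \<in> {0..1} \<Longrightarrow> closed (D t)"
    and "\<And>s t. s \<in> {0..1} \<Longrightarrow> t \<in> {0..1} \<Longrightarrow> s \<le> t \<Longrightarrow> D s \<subseteq> D t"
    and "measure \<mu> (D 0) = 0"
    and "\<And>t. t \<in> {0..<1} \<Longrightarrow> measure \<mu> (D t) < 1"
    and "D 1 = UNIV"
    and "\<And>t. t \<in> {0<..1} \<Longrightarrow> measure \<mu> (D t - (\<Union>s\<in>{0..<t}. D s)) = 0"
    and "\<And>t. t \<in> {0..<1} \<Longrightarrow> D t = (\<Inter>s\<in>{t<..1}. D s)"
    and "g \<in> borel_measurable borel"
    and "\<And>x. 0 \<le> g x"
    and "integrable \<mu> (\<lambda>x. (g x)\<^sup>2)"
  shows "Ent \<mu> g \<le> enn2ereal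
    (\<integral>\<^sup>+x\<in>{x. entry_time D x < 1}.
       ennreal ((g x - avg_outside \<mu> D g (entry_time D x))\<^sup>2)
         / ennreal (avg_outside \<mu> D g (entry_time D x)) \<partial>\<mu>)"
proof -
  interpret prob_space \<mu> by fact
  note closed_D = assms(3) and mono_D = assms(4) and right_cont = assms(9)
  have space_eq: "space \<mu> = UNIV" using sets_eq_imp_space_eq[OF assms(2)] by simp
  let ?\<tau> = "entry_time D"
  have bdd: "bdd_below {t \<in> {0..1}. x \<in> D t}" for x by (rule bdd_belowI[of _ 0]) auto
  have one_mem: "1 \<in> {t \<in> {0..1}. x \<in> D t}" for x using assms(7) by simp
  have nonneg: "0 \<le> ?\<tau> x" for x
    unfolding entry_time_def by (rule cInf_greatest) (use one_mem in blast, auto)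
  have le_one: "?\<tau> x \<le> 1" for x
    unfolding entry_time_def by (rule cInf_lower[OF one_mem bdd])
  \<comment> \<open>Right-continuity of the family makes the infimum in the entry time attained.\<close>
  have D_eq: "x \<in> D t \<longleftrightarrow> ?\<tau> x \<le> t" if t: "t \<in> {0..1}" for x t
  proof
    assume "x \<in> D t"
    then show "?\<tau> x \<le> t"
      unfolding entry_time_def using t by (intro cInf_lower bdd) auto
  next
    assume le: "?\<tau> x \<le> t"
    show "x \<in> D t"
    proof (cases "t = 1")
      case False
      have "x \<in> D s" if "s \<in> {t<..1}" for s
      proof -
        have "Inf {t \<in> {0..1}. x \<in> D t} < s" using le that by (simp add: entry_time_def)
        then obtain r where "r \<in> {0..1}" "x \<in> D r" "r < s"
          using cInf_lessD[of "{t \<in> {0..1}. x \<in> D t}" s] one_mem by blast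
        then show ?thesis using mono_D[of r s] that t by auto
      qed
      then show ?thesis using right_cont[of t] False t by auto
    qed (simp add: assms(7))
  qed
  have D_measurable: "D t \<in> sets \<mu>" if "t \<in> {0..1}" for t
    using closed_D[OF that] assms(2) by auto
  have meas: "?\<tau> \<in> borel_measurable \<mu>"
  proof (rule borel_measurable_iff_le[THEN iffD2], rule allI)
    fix a :: real
    \<comment> \<open>Outside the unit interval \<open>D a\<close> is arbitrary, so those levels are treated by the range of \<open>\<tau>\<close>.\<close>
    consider "a < 0" | "a \<in> {0..1}" | "a > 1"
      unfolding atLeastAtMost_iff by linarith
    then show "{x \<in> space \<mu>. ?\<tau> x \<le> a} \<in> sets \<mu>"
    proof cases
      case 1
      then have "{x \<in> space \<mu>. ?\<tau> x \<le> a} = {}" using order_less_le_trans[OF _ nonneg] by (auto simp: not_le)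
      then show ?thesis by (simp only: sets.empty_sets)
    next
      case 2
      then have "{x \<in> space \<mu>. ?\<tau> x \<le> a} = D a" using D_eq by (auto simp: space_eq)
      then show ?thesis using D_measurable[OF 2] by simp
    next
      case 3
      then have "{x \<in> space \<mu>. ?\<tau> x \<le> a} = space \<mu>" using order_trans[OF le_one] by auto
      then show ?thesis by simp
    qed
  qed
  have atomless: "AE x in \<mu>. ?\<tau> x \<noteq> t" for t
  proof -
    note [measurable] = meas
    have "measure \<mu> {x \<in> space \<mu>. ?\<tau> x = t} = 0"
    proof -
      consider "t = 0" | "t \<in> {0<..1}" | "t < 0 \<or> t > 1"
        unfolding greaterThanAtMost_iff by linarith
      then show ?thesis
      proof cases
        case 1
        then have "{x \<in> space \<mu>. ?\<tau> x = t} = D 0"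
          using D_eq[of 0] nonneg by (auto simp: space_eq intro: antisym)
        then show ?thesis using assms(5) by simp
      next
        case 2
        have "x \<in> D t - (\<Union>s\<in>{0..<t}. D s) \<longleftrightarrow> ?\<tau> x = t" for x
        proof
          assume x: "x \<in> D t - (\<Union>s\<in>{0..<t}. D s)"
          then have "?\<tau> x \<le> t" using D_eq 2 by auto
          moreover have "\<not> ?\<tau> x < t"
          proof
            assume "?\<tau> x < t"
            moreover have "x \<in> D (?\<tau> x)" using D_eq[of "?\<tau> x"] nonneg le_one by simp
            ultimately show False using x nonneg by auto
          qed
          ultimately show "?\<tau> x = t" by simp
        next
          assume "?\<tau> x = t"
          then show "x \<in> D t - (\<Union>s\<in>{0..<t}. D s)" using D_eq 2 by auto
        qed
        then have "{x \<in> space \<mu>. ?\<tau> x = t} = D t - (\<Union>s\<in>{0..<t}. D s)" by (auto simp: space_eq)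
        then show ?thesis using assms(8)[OF 2] by simp
      next
        case 3
        then have "{x \<in> space \<mu>. ?\<tau> x = t} = {}" using nonneg le_one by (fastforce simp: not_le[symmetric])
        then show ?thesis by (simp only: measure_empty)
      qed
    qed
    then show ?thesis
      by (intro AE_I[of _ _ "{x \<in> space \<mu>. ?\<tau> x = t}"]) (auto simp: emeasure_eq_measure)
  qed
  interpret time: atomless_time \<mu> ?\<tau> g
    using assms(2,10,11,12) meas atomless nonneg le_one
    by unfold_locales (auto cong: measurable_cong_sets)
  have avg: "avg_outside \<mu> D g t = time.mean t" if "t \<in> {0..1}" for t
  proof -
    have "- D t = time.later t" using D_eq[OF that] by (auto simp: time.later_def space_eq)
    then show ?thesis by (simp add: avg_outside_def time.mean_def time.mass_def)
  qed
  \<comment> \<open>The event \<open>\<tau> = 1\<close>, beyond which there is nothing to average over, is null.\<close>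
  have "time.energy = (\<integral>\<^sup>+x\<in>{x. ?\<tau> x < 1}.
       ennreal ((g x - avg_outside \<mu> D g (?\<tau> x))\<^sup>2) / ennreal (avg_outside \<mu> D g (?\<tau> x)) \<partial>\<mu>)"
    unfolding time.energy_def
  proof (rule nn_integral_cong_AE)
    show "AE x in \<mu>. ennreal ((g x - time.mean (?\<tau> x))\<^sup>2) / ennreal (time.mean (?\<tau> x)) =
        ennreal ((g x - avg_outside \<mu> D g (?\<tau> x))\<^sup>2) / ennreal (avg_outside \<mu> D g (?\<tau> x))
          * indicator {x. ?\<tau> x < 1} x"
      using atomless[of 1]
    proof eventually_elim
      case (elim x)
      then have "?\<tau> x < 1" using le_one[of x] by simp
      then show ?case using avg[of "?\<tau> x"] nonneg[of x] by simp
    qed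
  qed
  then show ?thesis using time.Ent_le_energy by simp
qed

end
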